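(* Let $L=L(a,b)$ be the free Lie ring (Lie algebra over $\mathbb{Z}$) on two letters $a,b$, and let $I_{3,m}$ be the kernel of the map $\Theta_{3,m}:L_{2,m}\oplus L_{3,m-1}\to L_{3,m}$, $\Theta_{3,m}(A,B)=[A,a]+[B,b]$. Then for every integer $m\ge 1$, $$\dim I_{3,m}=\left\lceil\frac{m}{2}\right\rceil-\left\lfloor\frac{m-1}{3}\right\rfloor-1.$$
   Context: $L_{k,m}\subseteq L$ denotes the abelian subgroup generated by all iterated commutators in which $a$ occurs exactly $k$ times and $b$ occurs exactly $m$ times. For a free abelian group $X$, $\dim X$ denotes its rank. *)

theory Defs
  imports Complex_Main "HOL-Algebra.Free_Abelian_Groups"
begin

section \<open>Lie rings\<close>

text \<open>Alternation is required in the form \<open>[x,x] = 0\<close>, since a Lie ring may have 2-torsion.\<close>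

class lie_ring = ab_group_add +
  fixes lie_bracket :: "'a \<Rightarrow> 'a \<Rightarrow> 'a"
  assumes lie_bracket_add_left: "lie_bracket (x + y) z = lie_bracket x z + lie_bracket y z"
    and lie_bracket_add_right: "lie_bracket x (y + z) = lie_bracket x y + lie_bracket x z"
    and lie_bracket_self: "lie_bracket x x = 0"
    and lie_jacobi: "lie_bracket x (lie_bracket y z) + lie_bracket y (lie_bracket z x)
                       + lie_bracket z (lie_bracket x y) = 0"

section \<open>The free Lie ring on a type of letters\<close>

text \<open>
  The free non-associative ring on \<open>'x\<close> is the free abelian group on the bracketed words
  (the free magma), with multiplication extended bilinearly. The free Lie ring is its quotient by
  the two-sided ideal generated by all \<open>x \<cdot> x\<close> and all Jacobi sums.
\<close>

datatype 'x magma = Letter 'x | Node "'x magma" "'x magma"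

definition na_mult :: "('x magma \<Rightarrow>\<^sub>0 int) \<Rightarrow> ('x magma \<Rightarrow>\<^sub>0 int) \<Rightarrow> ('x magma \<Rightarrow>\<^sub>0 int)" where
  "na_mult x y = frag_extend (\<lambda>s. frag_extend (\<lambda>t. frag_of (Node s t)) y) x"

inductive_set lie_ideal :: "('x magma \<Rightarrow>\<^sub>0 int) set" where
  zero: "0 \<in> lie_ideal"
| diff: "x \<in> lie_ideal \<Longrightarrow> y \<in> lie_ideal \<Longrightarrow> x - y \<in> lie_ideal"
| mult_left: "x \<in> lie_ideal \<Longrightarrow> na_mult y x \<in> lie_ideal"
| mult_right: "x \<in> lie_ideal \<Longrightarrow> na_mult x y \<in> lie_ideal"
| square: "na_mult x x \<in> lie_ideal"
| jacobi: "na_mult x (na_mult y z) + na_mult y (na_mult z x) + na_mult z (na_mult x y) \<in> lie_ideal"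

lemma lie_ideal_uminus: "x \<in> lie_ideal \<Longrightarrow> - x \<in> lie_ideal"
  using lie_ideal.diff[OF lie_ideal.zero] by force

lemma lie_ideal_add: "x \<in> lie_ideal \<Longrightarrow> y \<in> lie_ideal \<Longrightarrow> x + y \<in> lie_ideal"
  using lie_ideal.diff[of x "- y"] lie_ideal_uminus[of y] by simp

lemma na_mult_diff_left: "na_mult (x - y) z = na_mult x z - na_mult y z"
  by (simp add: na_mult_def frag_extend_diff)

lemma na_mult_add_left: "na_mult (x + y) z = na_mult x z + na_mult y z"
  by (simp add: na_mult_def frag_extend_add)

lemma na_mult_zero_left [simp]: "na_mult 0 z = 0"
  by (simp add: na_mult_def)

lemma na_mult_zero_right [simp]: "na_mult z 0 = 0"
  by (simp add: na_mult_def frag_extend_eq_0)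

lemma na_mult_of_left: "na_mult (frag_of s) y = frag_extend (\<lambda>t. frag_of (Node s t)) y"
  by (simp add: na_mult_def)

lemma na_mult_diff_right: "na_mult x (y - z) = na_mult x y - na_mult x z"
  using subset_UNIV
  by (induction x rule: frag_induction)
     (auto simp: na_mult_of_left na_mult_diff_left frag_extend_diff)

lemma na_mult_add_right: "na_mult x (y + z) = na_mult x y + na_mult x z"
  using na_mult_diff_right[of x "y + z" z] by (simp add: algebra_simps)

quotient_type 'x free_lie = "'x magma \<Rightarrow>\<^sub>0 int" / "\<lambda>x y. x - y \<in> lie_ideal"
proof (rule equivpI)
  show "reflp (\<lambda>x y :: 'x magma \<Rightarrow>\<^sub>0 int. x - y \<in> lie_ideal)"
    by (rule reflpI) (simp add: lie_ideal.zero)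
  show "symp (\<lambda>x y :: 'x magma \<Rightarrow>\<^sub>0 int. x - y \<in> lie_ideal)"
    by (rule sympI) (metis lie_ideal_uminus minus_diff_eq)
  show "transp (\<lambda>x y :: 'x magma \<Rightarrow>\<^sub>0 int. x - y \<in> lie_ideal)"
  proof (rule transpI)
    fix x y z :: "'x magma \<Rightarrow>\<^sub>0 int"
    assume "x - y \<in> lie_ideal" "y - z \<in> lie_ideal"
    from lie_ideal_add[OF this] show "x - z \<in> lie_ideal" by simp
  qed
qed

instantiation free_lie :: (type) lie_ring
begin

lift_definition zero_free_lie :: "'a free_lie" is 0 .

lift_definition plus_free_lie :: "'a free_lie \<Rightarrow> 'a free_lie \<Rightarrow> 'a free_lie" is "(+)"
proof -
  fix x y u v :: "'a magma \<Rightarrow>\<^sub>0 int"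
  assume "x - y \<in> lie_ideal" "u - v \<in> lie_ideal"
  from lie_ideal_add[OF this] show "(x + u) - (y + v) \<in> lie_ideal"
    by (simp add: algebra_simps)
qed

lift_definition uminus_free_lie :: "'a free_lie \<Rightarrow> 'a free_lie" is uminus
proof -
  fix x y :: "'a magma \<Rightarrow>\<^sub>0 int"
  assume "x - y \<in> lie_ideal"
  from lie_ideal_uminus[OF this] show "- x - - y \<in> lie_ideal"
    by simp
qed

lift_definition minus_free_lie :: "'a free_lie \<Rightarrow> 'a free_lie \<Rightarrow> 'a free_lie" is "(-)"
proof -
  fix x y u v :: "'a magma \<Rightarrow>\<^sub>0 int"
  assume "x - y \<in> lie_ideal" "u - v \<in> lie_ideal"
  from lie_ideal.diff[OF this] show "(x - u) - (y - v) \<in> lie_ideal"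
    by (simp add: algebra_simps)
qed

lift_definition lie_bracket_free_lie :: "'a free_lie \<Rightarrow> 'a free_lie \<Rightarrow> 'a free_lie" is na_mult
proof -
  fix x y u v :: "'a magma \<Rightarrow>\<^sub>0 int"
  assume "x - y \<in> lie_ideal" "u - v \<in> lie_ideal"
  then have "na_mult (x - y) u + na_mult y (u - v) \<in> lie_ideal"
    by (intro lie_ideal_add lie_ideal.mult_right lie_ideal.mult_left)
  then show "na_mult x u - na_mult y v \<in> lie_ideal"
    by (simp add: na_mult_diff_left na_mult_diff_right)
qed

instance
  by standard
     (transfer, simp add: algebra_simps na_mult_add_left na_mult_add_right
        lie_ideal.zero lie_ideal.square lie_ideal.jacobi[unfolded add.assoc])+

end

lift_definition free_lie_of :: "'x \<Rightarrow> 'x free_lie" is "\<lambda>c. frag_of (Letter c)" .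

section \<open>Additive groups and rank\<close>

definition additive_group :: "'a::ab_group_add monoid" where
  "additive_group = \<lparr>carrier = UNIV, monoid.mult = (+), one = 0\<rparr>"

lemma additive_group_simps [simp]:
  "carrier additive_group = UNIV"
  "mult additive_group = (+)"
  "\<one>\<^bsub>additive_group\<^esub> = 0"
  by (simp_all add: additive_group_def)

lemma comm_group_additive_group: "comm_group (additive_group :: 'a::ab_group_add monoid)"
  by (rule comm_groupI) (auto simp: algebra_simps intro: exI[of _ "- _"] left_minus)

text \<open>Meaningful only for free abelian groups of finite rank; otherwise the value is unspecified.\<close>

definition free_rank :: "('a, 'b) monoid_scheme \<Rightarrow> nat" where
  "free_rank G = (THE n. G \<cong> free_Abelian_group {..<n :: nat})"

lemma free_rank_eqI:
  assumes "G \<cong> free_Abelian_group {..<n :: nat}" and "group G"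
  shows "free_rank G = n"
  unfolding free_rank_def
proof (rule the_equality)
  fix k :: nat assume "G \<cong> free_Abelian_group {..<k}"
  then have "free_Abelian_group {..<k} \<cong> free_Abelian_group {..<n}"
    using assms group.iso_sym iso_trans by blast
  then have "{..<k} \<approx> {..<n}"
    by (simp add: isomorphic_free_Abelian_groups)
  then show "k = n"
    by (metis card_lessThan eqpoll_iff_card finite_lessThan)
qed (rule assms)

section \<open>Universal property of the free Lie ring\<close>

primrec magma_eval :: "('x \<Rightarrow> 'r::lie_ring) \<Rightarrow> 'x magma \<Rightarrow> 'r" where
  "magma_eval f (Letter c) = f c"
| "magma_eval f (Node s t) = lie_bracket (magma_eval f s) (magma_eval f t)"

definition lie_hom :: "('r::lie_ring \<Rightarrow> 's::lie_ring) \<Rightarrow> bool" where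
  "lie_hom h \<longleftrightarrow> (\<forall>x y. h (x + y) = h x + h y) \<and>
                  (\<forall>x y. h (lie_bracket x y) = lie_bracket (h x) (h y))"

lemma frag_additive_eqI:
  fixes h g :: "('x \<Rightarrow>\<^sub>0 int) \<Rightarrow> 'r::ab_group_add"
  assumes h: "\<And>x y. h (x + y) = h x + h y" and g: "\<And>x y. g (x + y) = g x + g y"
    and eq: "\<And>t. h (frag_of t) = g (frag_of t)"
  shows "h x = g x"
proof -
  have 0: "h 0 = 0" "g 0 = 0"
    using h[of 0 0] g[of 0 0] by simp_all
  have diff: "h (x - y) = h x - h y" "g (x - y) = g x - g y" for x y
    using h[of "x - y" y] g[of "x - y" y] by (simp_all add: algebra_simps)
  show ?thesis
    using subset_UNIV by (induction x rule: frag_induction) (simp_all add: 0 diff eq)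
qed

theorem free_lie_universal:
  fixes f :: "'x \<Rightarrow> 'r::lie_ring"
  shows "\<exists>!h. lie_hom h \<and> (\<forall>c. h (free_lie_of c) = f c)"
proof -
  interpret comm_group "additive_group :: 'r monoid"
    by (rule comm_group_additive_group)
  obtain p :: "('x magma \<Rightarrow>\<^sub>0 int) \<Rightarrow> 'r"
    where p: "p \<in> hom (free_Abelian_group UNIV) additive_group"
      and p_of: "\<And>t. p (frag_of t) = magma_eval f t"
    using free_Abelian_group_universal[of "magma_eval f" UNIV] by auto
  have p_add: "p (x + y) = p x + p y" for x y
    using hom_mult[OF p, of x y] by simp
  have p_0: "p 0 = 0"
    using p_add[of 0 0] by simp
  have p_diff: "p (x - y) = p x - p y" for x y
    using p_add[of "x - y" y] by (simp add: algebra_simps)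
  have br_0: "lie_bracket 0 z = 0" "lie_bracket z 0 = 0" for z :: 'r
    using lie_bracket_add_left[of 0 0 z] lie_bracket_add_right[of z 0 0] by simp_all
  have p_mult: "p (na_mult x y) = lie_bracket (p x) (p y)" for x y
  proof (rule frag_additive_eqI[of "\<lambda>x. p (na_mult x y)" "\<lambda>x. lie_bracket (p x) (p y)"])
    fix t
    show "p (na_mult (frag_of t) y) = lie_bracket (p (frag_of t)) (p y)"
      by (rule frag_additive_eqI[of "\<lambda>y. p (na_mult (frag_of t) y)"])
         (simp_all add: p_add na_mult_add_right lie_bracket_add_right p_of na_mult_of_left)
  qed (simp_all add: p_add na_mult_add_left lie_bracket_add_left)
  have p_ideal: "p x = 0" if "x \<in> lie_ideal" for x
    using that
    by induction (simp_all add: p_0 p_diff p_mult br_0 lie_bracket_self p_add lie_jacobi)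
  define h where "h x = p (rep_free_lie x)" for x
  have h_abs: "h (abs_free_lie x) = p x" for x
  proof -
    have "rep_free_lie (abs_free_lie x) - x \<in> lie_ideal"
      by (rule Quotient_rep_abs[OF Quotient_free_lie]) (simp add: lie_ideal.zero)
    from p_ideal[OF this] show ?thesis
      by (simp add: h_def p_diff)
  qed
  have hom_h: "lie_hom h"
    unfolding lie_hom_def
  proof (intro conjI allI)
    fix x y :: "'x free_lie"
    obtain u v where "x = abs_free_lie u" "y = abs_free_lie v"
      using Quotient_abs_rep[OF Quotient_free_lie, of x, symmetric]
        Quotient_abs_rep[OF Quotient_free_lie, of y, symmetric] by (rule that)
    then show "h (x + y) = h x + h y" "h (lie_bracket x y) = lie_bracket (h x) (h y)"
      by (simp_all add: plus_free_lie.abs_eq lie_bracket_free_lie.abs_eq h_abs p_add p_mult)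
  qed
  have h_of: "h (free_lie_of c) = f c" for c
    by (simp add: free_lie_of.abs_eq h_abs p_of)
  show ?thesis
  proof (rule ex1I[of _ h])
    show "lie_hom h \<and> (\<forall>c. h (free_lie_of c) = f c)"
      using hom_h h_of by simp
  next
    fix g assume g: "lie_hom g \<and> (\<forall>c. g (free_lie_of c) = f c)"
    have "g (abs_free_lie (frag_of t)) = magma_eval f t" for t
    proof (induction t)
      case (Letter c)
      then show ?case
        using g by (simp add: free_lie_of.abs_eq[symmetric])
    next
      case (Node s t)
      have "abs_free_lie (frag_of (Node s t)) =
            lie_bracket (abs_free_lie (frag_of s)) (abs_free_lie (frag_of t))"
        by (simp add: lie_bracket_free_lie.abs_eq na_mult_def)
      with Node g show ?case
        by (simp add: lie_hom_def)
    qed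
    with g have g_abs: "g (abs_free_lie u) = p u" for u
      by - (rule frag_additive_eqI[of "\<lambda>u. g (abs_free_lie u)" p],
            simp_all add: lie_hom_def p_add p_of plus_free_lie.abs_eq[symmetric])
    show "g = h"
    proof
      fix x show "g x = h x"
        by (induction x rule: free_lie.abs_induct) (simp add: g_abs h_abs)
    qed
  qed
qed

section \<open>The bihomogeneous components of the free Lie ring on two letters\<close>

datatype letter = Letter_A | Letter_B

abbreviation gen_a :: "letter free_lie" where "gen_a \<equiv> free_lie_of Letter_A"
abbreviation gen_b :: "letter free_lie" where "gen_b \<equiv> free_lie_of Letter_B"

text \<open>
  \<open>iter_comm k m x\<close>: \<open>x\<close> is an iterated commutator, bracketed in any way, with \<open>k\<close> occurrences of
  \<open>gen_a\<close> and \<open>m\<close> of \<open>gen_b\<close>; the letters are the commutators of length one.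
\<close>

inductive iter_comm :: "nat \<Rightarrow> nat \<Rightarrow> letter free_lie \<Rightarrow> bool" where
  gen_a: "iter_comm 1 0 gen_a"
| gen_b: "iter_comm 0 1 gen_b"
| bracket: "iter_comm k m x \<Longrightarrow> iter_comm k' m' y \<Longrightarrow>
    iter_comm (k + k') (m + m') (lie_bracket x y)"

definition lie_component :: "nat \<Rightarrow> nat \<Rightarrow> letter free_lie monoid" where
  "lie_component k m = subgroup_generated additive_group {x. iter_comm k m x}"

lemma group_lie_component: "group (lie_component k m)"
  unfolding lie_component_def
  by (rule group.group_subgroup_generated)
     (rule comm_group.axioms(2)[OF comm_group_additive_group])

definition Theta :: "letter free_lie \<times> letter free_lie \<Rightarrow> letter free_lie" where
  "Theta = (\<lambda>(x, y). lie_bracket x gen_a + lie_bracket y gen_b)"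

lemma lie_component_mult [simp]: "mult (lie_component k m) = (+)"
  by (simp add: lie_component_def)

lemma lie_component_bracket:
  assumes "x \<in> carrier (lie_component k m)" and "iter_comm k' m' y"
  shows "lie_bracket x y \<in> carrier (lie_component (k + k') (m + m'))"
proof -
  have G: "group (additive_group :: letter free_lie monoid)"
    using comm_group_additive_group by (rule comm_group.axioms(2))
  have inv_eq: "inv\<^bsub>additive_group\<^esub> z = - z" for z :: "letter free_lie"
    by (rule group.inv_equality[OF G]) simp_all
  have zero: "lie_bracket 0 y = 0"
    using lie_bracket_add_left[of 0 0 y] by simp
  have uminus: "lie_bracket (- z) y = - lie_bracket z y" for z
    using lie_bracket_add_left[of "- z" z y] zero by (simp add: eq_neg_iff_add_eq_0)
  have "x \<in> generate additive_group {x. iter_comm k m x}"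
    using assms(1) by (simp add: lie_component_def carrier_subgroup_generated)
  then show ?thesis
    unfolding lie_component_def carrier_subgroup_generated additive_group_simps Int_UNIV_left
  proof induction
    case one
    show ?case
      using generate.one[of additive_group] by (simp only: zero additive_group_simps)
  next
    case (incl h)
    then show ?case
      by (intro generate.incl CollectI iter_comm.bracket assms(2)) simp
  next
    case (inv h)
    then have "inv\<^bsub>additive_group\<^esub> (lie_bracket h y)
        \<in> generate additive_group {x. iter_comm (k + k') (m + m') x}"
      by (intro generate.inv CollectI iter_comm.bracket assms(2)) simp
    then show ?case
      by (simp only: inv_eq uminus)
  next
    case (eng u v)
    from generate.eng[OF eng.IH] show ?case
      by (simp only: lie_bracket_add_left additive_group_simps)
  qed
qed

lemma Theta_hom:
  assumes "k \<ge> 1" and "m \<ge> 1"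
  shows "Theta \<in> hom (lie_component (k - 1) m \<times>\<times> lie_component k (m - 1)) (lie_component k m)"
proof (rule homI)
  fix z assume "z \<in> carrier (lie_component (k - 1) m \<times>\<times> lie_component k (m - 1))"
  then obtain x y where z: "z = (x, y)" and x: "x \<in> carrier (lie_component (k - 1) m)"
    and y: "y \<in> carrier (lie_component k (m - 1))"
    by auto
  have "lie_bracket x gen_a \<in> carrier (lie_component k m)"
    using lie_component_bracket[OF x iter_comm.gen_a] assms by simp
  moreover have "lie_bracket y gen_b \<in> carrier (lie_component k m)"
    using lie_component_bracket[OF y iter_comm.gen_b] assms by simp
  ultimately have "lie_bracket x gen_a \<otimes>\<^bsub>lie_component k m\<^esub> lie_bracket y gen_b
      \<in> carrier (lie_component k m)"
    by (rule monoid.m_closed[OF group.is_monoid[OF group_lie_component]])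
  then show "Theta z \<in> carrier (lie_component k m)"
    by (simp add: z Theta_def)
qed (auto simp: Theta_def lie_bracket_add_left)

text \<open>The kernel of \<open>Theta\<close>, for \<open>k, m \<ge> 1\<close>.\<close>

definition Theta_kernel :: "nat \<Rightarrow> nat \<Rightarrow> (letter free_lie \<times> letter free_lie) monoid" where
  "Theta_kernel k m =
     (let G = lie_component (k - 1) m \<times>\<times> lie_component k (m - 1)
      in G\<lparr>carrier := kernel G (lie_component k m) Theta\<rparr>)"

end

theory Submission
  imports Defs "HOL-Library.Product_Plus"
begin

text \<open>
  With \<open>a\<^sub>i = (ad b)\<^sup>i a\<close>, the group \<open>L\<^bsub>2,m\<^esub>\<close> is free on the \<open>[a\<^sub>i, a\<^sub>j]\<close> with
  \<open>i < j\<close>, \<open>i + j = m\<close>, and \<open>L\<^bsub>3,m\<^esub>\<close> is free on the \<open>[[a\<^sub>i, a\<^sub>j], a\<^sub>k]\<close> with \<open>i < j\<close>,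
  \<open>i \<le> k\<close>, \<open>i + j + k = m\<close>: the Jacobi identity shows that they span, and a homomorphism into
  a truncated tensor algebra, extended by a shift derivation for \<open>b\<close>, shows that they are
  independent. Integration by parts with respect to \<open>ad b\<close> reduces \<open>[[a\<^sub>i, a\<^sub>j], a\<^sub>k]\<close> to
  \<open>k = 0\<close>, so \<open>\<Theta>\<close> is surjective, and the rank of its kernel is
  \<open>dim L\<^bsub>2,m\<^esub> + dim L\<^bsub>3,m-1\<^esub> - dim L\<^bsub>3,m\<^esub>\<close>. Raising \<open>k\<close> by one embeds the basis of
  \<open>L\<^bsub>3,m-1\<^esub>\<close> into that of \<open>L\<^bsub>3,m\<^esub>\<close> and misses exactly the triples with \<open>i = k\<close>.
\<close>

section \<open>Additive subgroups with a finite basis\<close>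

definition zmul :: "int \<Rightarrow> 'a::ab_group_add \<Rightarrow> 'a" where
  "zmul n x = x [^]\<^bsub>additive_group\<^esub> n"

lemma group_additive_group: "group (additive_group :: 'a::ab_group_add monoid)"
  using comm_group_additive_group by (rule comm_group.axioms(2))

lemma inv_additive_group [simp]: "inv\<^bsub>additive_group\<^esub> x = - x"
  by (rule group.inv_equality[OF group_additive_group]) simp_all

lemma zmul_0 [simp]: "zmul 0 x = 0"
  by (simp add: zmul_def)

lemma zmul_1 [simp]: "zmul 1 x = x"
  by (simp add: zmul_def group.int_pow_1[OF group_additive_group])

lemma zmul_add: "zmul (m + n) x = zmul m x + zmul n x"
  using group.int_pow_mult[OF group_additive_group, of x m n] by (simp add: zmul_def)

lemma zmul_diff: "zmul (m - n) x = zmul m x - zmul n x"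
  using zmul_add[of "m - n" n x] by (simp add: algebra_simps)

definition add_subgroup :: "'a::ab_group_add set \<Rightarrow> bool" where
  "add_subgroup H \<longleftrightarrow> 0 \<in> H \<and> (\<forall>x\<in>H. \<forall>y\<in>H. x - y \<in> H)"

lemma add_subgroupD:
  assumes "add_subgroup H"
  shows "0 \<in> H" and "x \<in> H \<Longrightarrow> y \<in> H \<Longrightarrow> x - y \<in> H" and "x \<in> H \<Longrightarrow> - x \<in> H"
    and "x \<in> H \<Longrightarrow> y \<in> H \<Longrightarrow> x + y \<in> H"
proof -
  show 0: "0 \<in> H" and d: "x \<in> H \<Longrightarrow> y \<in> H \<Longrightarrow> x - y \<in> H" for x y
    using assms by (auto simp: add_subgroup_def)
  show n: "x \<in> H \<Longrightarrow> - x \<in> H" for x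
    using d[OF 0, of x] by simp
  show "x \<in> H \<Longrightarrow> y \<in> H \<Longrightarrow> x + y \<in> H"
    using d[of x "- y"] n[of y] by simp
qed

lemma add_subgroup_zmul: "add_subgroup H \<Longrightarrow> x \<in> H \<Longrightarrow> zmul n x \<in> H"
  by (induction n rule: int_induct[of _ 0]) (simp_all add: zmul_add zmul_diff add_subgroupD)

lemma add_subgroup_sum:
  "add_subgroup H \<Longrightarrow> (\<And>i. i \<in> I \<Longrightarrow> f i \<in> H) \<Longrightarrow> sum f I \<in> H"
  by (induction I rule: infinite_finite_induct) (auto simp: add_subgroupD)

text \<open>Additivity is asked on \<open>H\<close> only, since a coordinate map need not be
  additive outside its subgroup: \<open>x div int n\<close> is additive on the multiples of
  \<open>n\<close> but not on all integers.\<close>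

definition additive_on :: "'a::ab_group_add set \<Rightarrow> ('a \<Rightarrow> 'b::ab_group_add) \<Rightarrow> bool" where
  "additive_on H f \<longleftrightarrow> (\<forall>x\<in>H. \<forall>y\<in>H. f (x + y) = f x + f y)"

lemma additive_onD:
  assumes "add_subgroup H" and "additive_on H f"
  shows "f 0 = 0" and "x \<in> H \<Longrightarrow> y \<in> H \<Longrightarrow> f (x + y) = f x + f y"
    and "x \<in> H \<Longrightarrow> y \<in> H \<Longrightarrow> f (x - y) = f x - f y"
    and "x \<in> H \<Longrightarrow> f (zmul n x) = zmul n (f x)"
    and "(\<And>i. i \<in> I \<Longrightarrow> g i \<in> H) \<Longrightarrow> f (sum g I) = (\<Sum>i\<in>I. f (g i))"
proof -
  show a: "x \<in> H \<Longrightarrow> y \<in> H \<Longrightarrow> f (x + y) = f x + f y" for x y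
    using assms by (auto simp: additive_on_def)
  show 0: "f 0 = 0"
    using a[of 0 0] add_subgroupD[OF assms(1)] by simp
  show d: "x \<in> H \<Longrightarrow> y \<in> H \<Longrightarrow> f (x - y) = f x - f y" for x y
    using a[of "x - y" y] add_subgroupD[OF assms(1)] by (simp add: algebra_simps)
  show "x \<in> H \<Longrightarrow> f (zmul n x) = zmul n (f x)"
    by (induction n rule: int_induct[of _ 0])
       (simp_all add: 0 a d zmul_add zmul_diff add_subgroup_zmul assms)
  show "(\<And>i. i \<in> I \<Longrightarrow> g i \<in> H) \<Longrightarrow> f (sum g I) = (\<Sum>i\<in>I. f (g i))"
    by (induction I rule: infinite_finite_induct) (auto simp: 0 a add_subgroup_sum assms)
qed

lemma zmul_int [simp]: "zmul n (k :: int) = n * k"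
  by (induction n rule: int_induct[of _ 0]) (simp_all add: zmul_add zmul_diff algebra_simps)

text \<open>A basis is stored together with its dual coordinate functions \<open>l\<close>; duality
  encodes linear independence and makes the coefficients explicit.\<close>

definition zbasis :: "'i set \<Rightarrow> ('i \<Rightarrow> 'a::ab_group_add) \<Rightarrow> ('i \<Rightarrow> 'a \<Rightarrow> int) \<Rightarrow> 'a set \<Rightarrow> bool" where
  "zbasis I e l H \<longleftrightarrow> finite I \<and> add_subgroup H \<and> e ` I \<subseteq> H \<and> (\<forall>i\<in>I. additive_on H (l i)) \<and>
     (\<forall>i\<in>I. \<forall>j\<in>I. l i (e j) = of_bool (i = j)) \<and> (\<forall>x\<in>H. x = (\<Sum>i\<in>I. zmul (l i x) (e i)))"

lemma zbasis_coord:
  assumes b: "zbasis I e l H" and j: "j \<in> I"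
  shows "l j (\<Sum>i\<in>I. zmul (c i) (e i)) = c j"
proof -
  have s: "add_subgroup H" and a: "additive_on H (l j)" and I: "finite I"
    and e: "\<And>i. i \<in> I \<Longrightarrow> e i \<in> H"
    using b j by (auto simp: zbasis_def)
  have "l j (\<Sum>i\<in>I. zmul (c i) (e i)) = (\<Sum>i\<in>I. l j (zmul (c i) (e i)))"
    by (rule additive_onD[OF s a]) (simp add: add_subgroup_zmul s e)
  also have "\<dots> = (\<Sum>i\<in>I. c i * of_bool (j = i))"
    using b j by (intro sum.cong) (auto simp: additive_onD[OF s a] e zbasis_def)
  also have "\<dots> = c j"
    using j I by (simp add: if_distrib sum.If_cases of_bool_def cong: if_cong)
  finally show ?thesis .
qed

text \<open>Subtracting from \<open>x\<close> the combination with coefficients \<open>l i x\<close>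
  leaves an element with all coordinates zero. Hence coordinates that jointly separate the points of
  \<open>H\<close> already yield the expansion.\<close>

lemma zbasisI:
  assumes "finite I" and H: "add_subgroup H" and "e ` I \<subseteq> H"
    and a: "\<And>i. i \<in> I \<Longrightarrow> additive_on H (l i)"
    and "\<And>i j. i \<in> I \<Longrightarrow> j \<in> I \<Longrightarrow> l i (e j) = of_bool (i = j)"
    and inj: "\<And>x. x \<in> H \<Longrightarrow> (\<And>i. i \<in> I \<Longrightarrow> l i x = 0) \<Longrightarrow> x = 0"
  shows "zbasis I e l H"
proof -
  have "x = (\<Sum>i\<in>I. zmul (l i x) (e i))" if x: "x \<in> H" for x
  proof -
    let ?s = "\<Sum>i\<in>I. zmul (l i x) (e i)"
    have e: "e i \<in> H" if "i \<in> I" for i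
      using assms(3) that by auto
    have s: "?s \<in> H"
      by (intro add_subgroup_sum add_subgroup_zmul H e)
    have "l j ?s = l j x" if j: "j \<in> I" for j
    proof -
      have "l j ?s = (\<Sum>i\<in>I. l j (zmul (l i x) (e i)))"
        by (rule additive_onD[OF H a[OF j]]) (simp add: add_subgroup_zmul H e)
      also have "\<dots> = (\<Sum>i\<in>I. l i x * of_bool (j = i))"
        using assms(5) j by (intro sum.cong) (auto simp: additive_onD[OF H a[OF j]] e)
      also have "\<dots> = l j x"
        using j assms(1) by (simp add: if_distrib sum.If_cases of_bool_def cong: if_cong)
      finally show ?thesis .
    qed
    then have "x - ?s = 0"
      by (intro inj) (auto simp: add_subgroupD H x s additive_onD[OF H a])
    then show ?thesis by simp
  qed
  then show ?thesis
    using assms by (auto simp: zbasis_def)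
qed

lemma zbasis_reindex:
  assumes b: "zbasis I e l H" and bij: "bij_betw g J I"
  shows "zbasis J (e \<circ> g) (l \<circ> g) H"
proof (rule zbasisI)
  have g: "g j \<in> I" if "j \<in> J" for j
    using bij that by (auto simp: bij_betw_def)
  show "finite J" "add_subgroup H" "(e \<circ> g) ` J \<subseteq> H" "\<And>j. j \<in> J \<Longrightarrow> additive_on H ((l \<circ> g) j)"
    using b g bij_betw_finite[OF bij] by (auto simp: zbasis_def)
  show "(l \<circ> g) i ((e \<circ> g) j) = of_bool (i = j)" if "i \<in> J" "j \<in> J" for i j
    using b g that bij by (auto simp: zbasis_def bij_betw_def inj_on_eq_iff)
  show "x = 0" if "x \<in> H" "\<And>i. i \<in> J \<Longrightarrow> (l \<circ> g) i x = 0" for x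
  proof -
    have "x = (\<Sum>i\<in>I. zmul (l i x) (e i))"
      using b that by (auto simp: zbasis_def)
    also have "\<dots> = 0"
      using that(2) bij by (intro sum.neutral) (force simp: bij_betw_def)
    finally show ?thesis .
  qed
qed

section \<open>Rank and comparison with free abelian groups\<close>

definition has_rank :: "'a::ab_group_add set \<Rightarrow> nat \<Rightarrow> bool" where
  "has_rank H n \<longleftrightarrow> (\<exists>e l. zbasis {..<n} e l H)"

lemma has_rankI:
  assumes "zbasis I e l H"
  shows "has_rank H (card I)"
proof -
  have "finite I"
    using assms by (simp add: zbasis_def)
  then obtain g where "bij_betw g {..<card I} I"
    using bij_betw_from_nat_into_finite bij_betw_iff_card by (metis card_lessThan finite_lessThan)
  then show ?thesis
    using zbasis_reindex[OF assms] by (auto simp: has_rank_def)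
qed

text \<open>With exactly these record fields, the kernel of \<open>Theta\<close> is equal to such a
  monoid, not merely isomorphic to one.\<close>

definition subgroup_monoid :: "'a::ab_group_add set \<Rightarrow> 'a monoid" where
  "subgroup_monoid H = \<lparr>carrier = H, monoid.mult = (+), one = 0\<rparr>"

lemma group_subgroup_monoid:
  assumes "add_subgroup H"
  shows "group (subgroup_monoid H)"
  by (rule groupI)
     (use assms in \<open>auto simp: subgroup_monoid_def add_subgroupD algebra_simps
        intro!: bexI[of _ "- _"]\<close>)

text \<open>A finitely supported coefficient function is sent to the combination of the
  \<open>e i\<close>. Duality makes this injective, the expansion makes it surjective, and the
  resulting isomorphism is then inverted.\<close>

lemma has_rank_iso:
  assumes "has_rank H n"
  shows "subgroup_monoid H \<cong> free_Abelian_group {..<n}"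
proof -
  obtain e l where b: "zbasis {..<n} e l H"
    using assms by (auto simp: has_rank_def)
  then have H: "add_subgroup H" and eH: "\<And>i. i < n \<Longrightarrow> e i \<in> H"
    and rep: "\<And>x. x \<in> H \<Longrightarrow> x = (\<Sum>i<n. zmul (l i x) (e i))"
    by (auto simp: zbasis_def)
  define h where "h c = (\<Sum>i<n. zmul (Poly_Mapping.lookup c i) (e i))" for c
  have "h \<in> iso (free_Abelian_group {..<n}) (subgroup_monoid H)"
  proof (rule isoI)
    show "h \<in> hom (free_Abelian_group {..<n}) (subgroup_monoid H)"
      by (rule homI)
         (auto simp: h_def subgroup_monoid_def lookup_add zmul_add sum.distrib
           intro!: add_subgroup_sum add_subgroup_zmul H eH)
    show "bij_betw h (carrier (free_Abelian_group {..<n})) (carrier (subgroup_monoid H))"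
      unfolding bij_betw_def
    proof
      show "inj_on h (carrier (free_Abelian_group {..<n}))"
      proof (rule inj_onI, rule poly_mapping_eqI)
        fix c d i
        assume cd: "c \<in> carrier (free_Abelian_group {..<n})"
          "d \<in> carrier (free_Abelian_group {..<n})" "h c = h d"
        show "Poly_Mapping.lookup c i = Poly_Mapping.lookup d i"
        proof (cases "i < n")
          case True
          then show ?thesis
            using cd(3) zbasis_coord[OF b, of i] unfolding h_def by (metis lessThan_iff)
        next
          case False
          then show ?thesis
            using cd(1,2) by (metis carrier_free_Abelian_group_iff in_keys_iff lessThan_iff subsetD)
        qed
      qed
      show "h ` carrier (free_Abelian_group {..<n}) = carrier (subgroup_monoid H)"
      proof (intro equalityI subsetI)
        fix x assume "x \<in> carrier (subgroup_monoid H)"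
        then have x: "x \<in> H" by (simp add: subgroup_monoid_def)
        define c where "c = Abs_poly_mapping (\<lambda>i. if i < n then l i x else 0)"
        have "finite {i. (if i < n then l i x else 0) \<noteq> 0}"
          by (rule finite_subset[of _ "{..<n}"]) auto
        then have c: "Poly_Mapping.lookup c i = (if i < n then l i x else 0)" for i
          by (simp add: c_def lookup_Abs_poly_mapping)
        have "h c = x"
          using rep[OF x] by (simp add: h_def c)
        moreover have "c \<in> carrier (free_Abelian_group {..<n})"
          by (auto simp: in_keys_iff c split: if_splits)
        ultimately show "x \<in> h ` carrier (free_Abelian_group {..<n})"
          by blast
      qed (auto simp: h_def subgroup_monoid_def intro!: add_subgroup_sum add_subgroup_zmul H eH)
    qed
  qed
  then show ?thesis
    using group.iso_sym[OF group_free_Abelian_group] is_isoI by blast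
qed

section \<open>Uniqueness and additivity of rank, and ranks of subgroups\<close>

lemma has_rank_unique:
  assumes "has_rank H m" and "has_rank H n"
  shows "m = n"
proof -
  have "group (subgroup_monoid H)"
    using assms by (auto simp: has_rank_def zbasis_def intro: group_subgroup_monoid)
  then show ?thesis
    using assms[THEN has_rank_iso] free_rank_eqI by metis
qed

text \<open>The image of \<open>f\<close> has a basis, so lifting its elements gives a section and
  \<open>H\<close> splits as the kernel plus the span of the lifts \<open>s j\<close>.\<close>

lemma zbasis_extend:
  assumes H: "add_subgroup H" and f: "additive_on H f"
    and bK: "zbasis I e l {x \<in> H. f x = 0}" and bM: "zbasis J e' l' (f ` H)"
  shows "\<exists>e'' l''. zbasis (I <+> J) e'' l'' H"
proof -
  obtain s where s: "\<And>j. j \<in> J \<Longrightarrow> s j \<in> H \<and> f (s j) = e' j"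
  proof -
    have "\<forall>j\<in>J. \<exists>x. x \<in> H \<and> f x = e' j"
      using bM by (force simp: zbasis_def)
    from bchoice[OF this] show ?thesis
      using that by blast
  qed
  note fD = additive_onD[OF H f] and HD = add_subgroupD[OF H]
  have M: "add_subgroup (f ` H)"
    using bM by (simp add: zbasis_def)
  have l': "additive_on (f ` H) (l' j)" if "j \<in> J" for j
    using bM that by (simp add: zbasis_def)
  note l'D = additive_onD[OF M l']
  \<comment> \<open>\<open>t\<close> is \<open>f\<close> followed by the section \<open>e' j\<close>
    to \<open>s j\<close>; thus \<open>x - t x\<close> projects \<open>H\<close> onto the kernel of
    \<open>f\<close>, where the coordinates \<open>l\<close> make sense.\<close>
  define t where "t x = (\<Sum>j\<in>J. zmul (l' j (f x)) (s j))" for x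
  have tH: "t x \<in> H" for x
    unfolding t_def by (intro add_subgroup_sum add_subgroup_zmul H) (simp add: s)
  have ft: "f (t x) = f x" if "x \<in> H" for x
  proof -
    have "f (t x) = (\<Sum>j\<in>J. f (zmul (l' j (f x)) (s j)))"
      unfolding t_def by (rule fD) (simp add: s H add_subgroup_zmul)
    also have "\<dots> = (\<Sum>j\<in>J. zmul (l' j (f x)) (e' j))"
      by (intro sum.cong) (simp_all add: fD s)
    also have "\<dots> = f x"
      using bM that by (auto simp: zbasis_def)
    finally show ?thesis .
  qed
  have t_add: "t (x + y) = t x + t y" if "x \<in> H" "y \<in> H" for x y
    using that by (simp add: t_def fD l'D zmul_add sum.distrib)
  have t_0: "t x = 0" if "f x = 0" for x
    using that by (simp add: t_def l'D)
  have t_s: "t (s j) = s j" if "j \<in> J" for j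
  proof -
    have "t (s j) = (\<Sum>i\<in>J. if i = j then s j else 0)"
      unfolding t_def using bM that by (intro sum.cong) (auto simp: s zbasis_def)
    then show ?thesis
      using bM that by (simp add: zbasis_def)
  qed
  define K where "K = {x \<in> H. f x = 0}"
  have K: "add_subgroup K" and l: "\<And>i. i \<in> I \<Longrightarrow> additive_on K (l i)"
    using bK by (auto simp: zbasis_def K_def)
  note lD = additive_onD[OF K l]
  have tK: "x - t x \<in> K" if "x \<in> H" for x
    using that by (simp add: K_def HD tH fD ft)
  define l'' where "l'' = case_sum (\<lambda>i x. l i (x - t x)) (\<lambda>j x. l' j (f x))"
  have "zbasis (I <+> J) (case_sum e s) l'' H"
  proof (rule zbasisI)
    show "finite (I <+> J)"
      using bK bM by (simp add: zbasis_def)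
    show "case_sum e s ` (I <+> J) \<subseteq> H"
      using bK s by (auto simp: zbasis_def)
    show "additive_on H (l'' i)" if i: "i \<in> I <+> J" for i
    proof (cases i)
      case (Inl i')
      then have i': "i' \<in> I" using i by auto
      have "l i' (x + y - t (x + y)) = l i' (x - t x) + l i' (y - t y)"
        if "x \<in> H" "y \<in> H" for x y
      proof -
        have "x + y - t (x + y) = (x - t x) + (y - t y)"
          using that by (simp add: t_add)
        then show ?thesis
          using i' that by (simp only: lD tK)
      qed
      then show ?thesis
        by (simp add: additive_on_def Inl l''_def)
    next
      case (Inr j)
      then show ?thesis
        using i by (auto simp: additive_on_def l''_def fD l'D)
    qed
    show "l'' i (case_sum e s j) = of_bool (i = j)" if "i \<in> I <+> J" "j \<in> I <+> J" for i j
    proof -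
      have "f (e i) = 0" if "i \<in> I" for i
        using bK that by (auto simp: zbasis_def)
      then show ?thesis
        using that bK bM by (auto simp: l''_def zbasis_def t_0 t_s s lD l'D)
    qed
    show "x = 0" if x: "x \<in> H" and 0: "\<And>i. i \<in> I <+> J \<Longrightarrow> l'' i x = 0" for x
    proof -
      have "l' j (f x) = 0" if "j \<in> J" for j
        using 0[of "Inr j"] that by (auto simp: l''_def)
      moreover have "f x = (\<Sum>j\<in>J. zmul (l' j (f x)) (e' j))"
        using bM x by (auto simp: zbasis_def)
      ultimately have fx: "f x = 0" by simp
      have "l i x = 0" if "i \<in> I" for i
        using 0[of "Inl i"] that by (auto simp: l''_def t_0 fx)
      moreover have "x = (\<Sum>i\<in>I. zmul (l i x) (e i))"
        using bK x fx by (auto simp: zbasis_def)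
      ultimately show ?thesis by simp
    qed
  qed (rule H)
  then show ?thesis by blast
qed

lemma has_rank_extend:
  assumes "add_subgroup H" and "additive_on H f"
    and "has_rank {x \<in> H. f x = 0} p" and "has_rank (f ` H) q"
  shows "has_rank H (p + q)"
proof -
  obtain e l e' l' where "zbasis {..<p} e l {x \<in> H. f x = 0}" "zbasis {..<q} e' l' (f ` H)"
    using assms(3,4) by (auto simp: has_rank_def)
  from zbasis_extend[OF assms(1,2) this] obtain e'' l''
    where "zbasis ({..<p} <+> {..<q}) e'' l'' H" by blast
  from has_rankI[OF this] show ?thesis
    by (simp add: card_Plus)
qed

text \<open>A nonzero subgroup of the integers consists of the multiples of its least positive
  element, because remainders stay in the subgroup.\<close>

lemma int_subgroup_has_rank:
  assumes H: "add_subgroup (H :: int set)"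
  shows "\<exists>q. has_rank H q"
proof (cases "H = {0}")
  case True
  have "zbasis {} undefined undefined H"
    by (rule zbasisI) (use H True in auto)
  from has_rankI[OF this] show ?thesis by blast
next
  case False
  note HD = add_subgroupD[OF H]
  then obtain x where "x \<in> H" "x \<noteq> 0"
    using False HD(1) by blast
  then have "\<exists>n::nat. n > 0 \<and> int n \<in> H"
    using HD(3)[of x] by (intro exI[of _ "nat \<bar>x\<bar>"]) (auto simp: abs_if)
  then obtain n where "n > 0 \<and> int n \<in> H" and "\<forall>k. k > 0 \<and> int k \<in> H \<longrightarrow> n \<le> k"
    unfolding exists_least_iff[of "\<lambda>n. n > 0 \<and> int n \<in> H"] by (metis not_le)
  then have n: "n > 0" "int n \<in> H" and least: "\<And>k. k > 0 \<Longrightarrow> int k \<in> H \<Longrightarrow> n \<le> k"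
    by auto
  have dvd: "int n dvd x" if "x \<in> H" for x
  proof (rule ccontr)
    assume "\<not> int n dvd x"
    then have "x mod int n > 0"
      using pos_mod_sign[of "int n" x] n by (simp add: dvd_eq_mod_eq_0 del: pos_mod_sign)
    moreover have "x mod int n = x - zmul (x div int n) (int n)"
      by (simp add: minus_div_mult_eq_mod)
    then have "x mod int n \<in> H"
      using that n by (simp only: HD add_subgroup_zmul[OF H])
    moreover have "x mod int n < int n"
      using n by simp
    ultimately show False
      using least[of "nat (x mod int n)"] by auto
  qed
  \<comment> \<open>Division by \<open>n\<close> is exact on \<open>H\<close> and therefore serves
    as the coordinate.\<close>
  have "zbasis {()} (\<lambda>_. int n) (\<lambda>_ x. x div int n) H"
  proof (rule zbasisI)
    show "additive_on H (\<lambda>x. x div int n)"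
      by (simp add: additive_on_def dvd)
    show "x = 0" if "x \<in> H" "\<And>i. i \<in> {()} \<Longrightarrow> x div int n = 0" for x
      using that dvd[of x] n by (auto simp: dvd_def)
  qed (use n H in auto)
  from has_rankI[OF this] show ?thesis by blast
qed

lemma add_subgroup_image:
  assumes H: "add_subgroup H" and f: "additive_on H f"
  shows "add_subgroup (f ` H)"
proof -
  have "0 = f 0"
    by (simp add: additive_onD[OF H f])
  moreover have "f x - f y = f (x - y)" if "x \<in> H" "y \<in> H" for x y
    using that by (simp add: additive_onD[OF H f])
  ultimately show ?thesis
    by (auto simp: add_subgroup_def intro!: image_eqI add_subgroupD[OF H])
qed

lemma add_subgroup_kernel:
  assumes "add_subgroup H" and "additive_on H f"
  shows "add_subgroup {x \<in> H. f x = 0}"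
  using assms by (auto simp: add_subgroup_def additive_onD[OF assms] add_subgroupD[OF assms(1)])

text \<open>Induction on the number of separating functionals: the last one has an image inside the
  integers, and its kernel is separated by the others. The two ranks combine by
  \<open>has_rank_extend\<close>.\<close>

lemma subgroup_has_rank:
  fixes c :: "nat \<Rightarrow> 'a::ab_group_add \<Rightarrow> int"
  assumes "add_subgroup H" and "\<And>i. i < n \<Longrightarrow> additive_on H (c i)"
    and "\<And>x. x \<in> H \<Longrightarrow> (\<And>i. i < n \<Longrightarrow> c i x = 0) \<Longrightarrow> x = 0"
  shows "\<exists>q. has_rank H q"
  using assms
proof (induction n arbitrary: H)
  case 0
  then have "zbasis {} undefined undefined H"
    by (intro zbasisI) (auto simp: add_subgroup_def)
  from has_rankI[OF this] show ?case by blast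
next
  case (Suc n)
  let ?K = "{x \<in> H. c n x = 0}"
  have "\<exists>q. has_rank ?K q"
  proof (rule Suc.IH)
    show "add_subgroup ?K"
      using Suc.prems by (intro add_subgroup_kernel) auto
    show "additive_on ?K (c i)" if "i < n" for i
      using Suc.prems(2)[of i] that by (auto simp: additive_on_def)
    show "x = 0" if "x \<in> ?K" "\<And>i. i < n \<Longrightarrow> c i x = 0" for x
      using that Suc.prems(3)[of x] by (auto simp: less_Suc_eq)
  qed
  moreover have "\<exists>q. has_rank (c n ` H) q"
    using Suc.prems by (intro int_subgroup_has_rank add_subgroup_image) auto
  ultimately show ?case
    using has_rank_extend[OF Suc.prems(1) Suc.prems(2)[of n]] by blast
qed

text \<open>The coordinates of \<open>H\<close> still separate points on the kernel, so the kernel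
  has some rank \<open>q\<close>; then \<open>H\<close> has rank both \<open>q + r\<close> and
  \<open>n\<close>, and rank is unique.\<close>

lemma rank_nullity:
  assumes "has_rank H n" and f: "additive_on H f" and "has_rank (f ` H) r"
  shows "\<exists>q. has_rank {x \<in> H. f x = 0} q \<and> q + r = n"
proof -
  obtain e l where b: "zbasis {..<n} e l H"
    using assms(1) by (auto simp: has_rank_def)
  then have H: "add_subgroup H" and rep: "\<And>x. x \<in> H \<Longrightarrow> x = (\<Sum>i<n. zmul (l i x) (e i))"
    by (auto simp: zbasis_def)
  have "\<exists>q. has_rank {x \<in> H. f x = 0} q"
  proof (rule subgroup_has_rank)
    show "add_subgroup {x \<in> H. f x = 0}"
      by (rule add_subgroup_kernel[OF H f])
    show "additive_on {x \<in> H. f x = 0} (l i)" if "i < n" for i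
      using b that by (auto simp: zbasis_def additive_on_def)
    show "x = 0" if "x \<in> {x \<in> H. f x = 0}" "\<And>i. i < n \<Longrightarrow> l i x = 0" for x
      using rep[of x] that by simp
  qed
  then obtain q where q: "has_rank {x \<in> H. f x = 0} q" by blast
  have "q + r = n"
    using has_rank_unique[OF has_rank_extend[OF H f q assms(3)] assms(1)] .
  with q show ?thesis by blast
qed

text \<open>This is the extension given by the second projection, whose kernel is a copy of
  \<open>G\<close>.\<close>

lemma has_rank_Times:
  assumes "has_rank G p" and "has_rank H q"
  shows "has_rank (G \<times> H) (p + q)"
proof -
  obtain e l e' l' where b: "zbasis {..<p} e l G" and b': "zbasis {..<q} e' l' H"
    using assms by (auto simp: has_rank_def)
  then have G: "add_subgroup G" and H: "add_subgroup H"
    by (auto simp: zbasis_def)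
  have GH: "add_subgroup (G \<times> H)"
    using G H by (auto simp: add_subgroup_def zero_prod_def)
  have f: "additive_on (G \<times> H) snd"
    by (auto simp: additive_on_def)
  have im: "snd ` (G \<times> H) = H"
    using add_subgroupD(1)[OF G] by force
  have "zbasis {..<p} (\<lambda>i. (e i, 0)) (\<lambda>i. l i \<circ> fst) {x \<in> G \<times> H. snd x = 0}"
  proof (rule zbasisI)
    show "add_subgroup {x \<in> G \<times> H. snd x = 0}"
      by (rule add_subgroup_kernel[OF GH f])
    show "(\<lambda>i. (e i, 0)) ` {..<p} \<subseteq> {x \<in> G \<times> H. snd x = 0}"
      using b add_subgroupD(1)[OF H] by (auto simp: zbasis_def)
    show "additive_on {x \<in> G \<times> H. snd x = 0} (l i \<circ> fst)" if "i \<in> {..<p}" for i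
      using b that by (auto simp: zbasis_def additive_on_def)
    show "x = 0" if "x \<in> {x \<in> G \<times> H. snd x = 0}" "\<And>i. i \<in> {..<p} \<Longrightarrow> (l i \<circ> fst) x = 0" for x
    proof -
      have "fst x = (\<Sum>i<p. zmul (l i (fst x)) (e i))"
        using b that by (auto simp: zbasis_def)
      then show ?thesis
        using that by (auto simp: prod_eq_iff)
    qed
  qed (use b in \<open>auto simp: zbasis_def\<close>)
  from has_rankI[OF this] have "has_rank {x \<in> G \<times> H. snd x = 0} p" by simp
  from has_rank_extend[OF GH f this] show ?thesis
    using assms(2) im by simp
qed

section \<open>Spans\<close>

definition zspan :: "'a::ab_group_add set \<Rightarrow> 'a set" where
  "zspan X = generate additive_group X"

lemma zspan_incl: "x \<in> X \<Longrightarrow> x \<in> zspan X"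
  by (simp add: zspan_def generate.incl)

lemma zspan_subset:
  assumes "add_subgroup H" and "X \<subseteq> H"
  shows "zspan X \<subseteq> H"
proof
  fix x assume "x \<in> zspan X"
  then show "x \<in> H"
    unfolding zspan_def by induction (use assms in \<open>auto simp: add_subgroupD\<close>)
qed

lemma add_subgroup_zspan: "add_subgroup (zspan X)"
proof -
  have 0: "0 \<in> zspan X"
    using generate.one[of additive_group X] by (simp add: zspan_def)
  have add: "x + y \<in> zspan X" if "x \<in> zspan X" "y \<in> zspan X" for x y
    using generate.eng[of x additive_group X y] that by (simp add: zspan_def)
  have "- x \<in> zspan X" if "x \<in> zspan X" for x
    using that group.generate_m_inv_closed[OF group_additive_group, of X x]
    by (simp add: zspan_def)
  then show ?thesis
    using 0 add by (auto simp: add_subgroup_def) (metis add_uminus_conv_diff)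
qed

lemmas zspan_rules = add_subgroupD[OF add_subgroup_zspan]

lemma carrier_lie_component: "carrier (lie_component k m) = zspan {x. iter_comm k m x}"
  by (simp add: lie_component_def carrier_subgroup_generated zspan_def)

lemma zbasis_zspan:
  fixes e :: "'i \<Rightarrow> 'a::ab_group_add"
  assumes I: "finite I" and a: "\<And>i. i \<in> I \<Longrightarrow> additive_on UNIV (l i)"
    and d: "\<And>i j. i \<in> I \<Longrightarrow> j \<in> I \<Longrightarrow> l i (e j) = of_bool (i = j)"
  shows "zbasis I e l (zspan (e ` I))"
proof (rule zbasisI)
  have U: "add_subgroup (UNIV :: 'a set)"
    by (simp add: add_subgroup_def)
  \<comment> \<open>The elements equal to their own expansion form a subgroup that contains every
    \<open>e i\<close>, hence the whole span.\<close>
  define H where "H = {x. x = (\<Sum>i\<in>I. zmul (l i x) (e i))}"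
  have "add_subgroup H"
    using I unfolding add_subgroup_def H_def
    by (auto simp: additive_onD[OF U a] zmul_diff sum_subtractf)
  moreover have "e ` I \<subseteq> H"
  proof clarify
    fix j assume j: "j \<in> I"
    have "(\<Sum>i\<in>I. zmul (l i (e j)) (e i)) = (\<Sum>i\<in>I. if i = j then e j else 0)"
      by (intro sum.cong) (auto simp: d j)
    then show "e j \<in> H"
      using I j by (simp add: H_def)
  qed
  ultimately have "zspan (e ` I) \<subseteq> H"
    by (rule zspan_subset)
  then have rep: "x = (\<Sum>i\<in>I. zmul (l i x) (e i))" if "x \<in> zspan (e ` I)" for x
    using that by (auto simp: H_def)
  show "x = 0" if "x \<in> zspan (e ` I)" "\<And>i. i \<in> I \<Longrightarrow> l i x = 0" for x
    using rep[OF that(1)] that(2) by simp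
  show "additive_on (zspan (e ` I)) (l i)" if "i \<in> I" for i
    using a[OF that] by (simp add: additive_on_def)
qed (use I d in \<open>auto simp: zspan_incl add_subgroup_zspan\<close>)

section \<open>Lie brackets\<close>

lemma lie_bracket_zero [simp]:
  "lie_bracket 0 (x :: 'a::lie_ring) = 0" "lie_bracket (x :: 'a::lie_ring) 0 = 0"
  using lie_bracket_add_left[of 0 0 x] lie_bracket_add_right[of x 0 0] by simp_all

lemma lie_bracket_minus:
  fixes x y :: "'a::lie_ring"
  shows "lie_bracket (- x) y = - lie_bracket x y" "lie_bracket x (- y) = - lie_bracket x y"
  using lie_bracket_add_left[of "- x" x y] lie_bracket_add_right[of x "- y" y]
  by (simp_all add: eq_neg_iff_add_eq_0)

lemma lie_bracket_diff:
  fixes x y z :: "'a::lie_ring"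
  shows "lie_bracket (x - y) z = lie_bracket x z - lie_bracket y z"
    "lie_bracket x (y - z) = lie_bracket x y - lie_bracket x z"
  using lie_bracket_add_left[of x "- y" z] lie_bracket_add_right[of x y "- z"]
  by (simp_all add: lie_bracket_minus)

lemma lie_bracket_swap: "lie_bracket (x :: 'a::lie_ring) y = - lie_bracket y x"
proof -
  have "lie_bracket (x + y) (x + y) = lie_bracket x y + lie_bracket y x"
    unfolding lie_bracket_add_left lie_bracket_add_right by (simp add: lie_bracket_self)
  then show ?thesis
    by (simp add: lie_bracket_self eq_neg_iff_add_eq_0)
qed

text \<open>The Jacobi identity in Leibniz form; with \<open>x = gen_b\<close> it describes how
  \<open>ad b\<close> raises the indices in \<open>comm2\<close> and \<open>comm3\<close>.\<close>

lemma lie_bracket_derivation: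
  "lie_bracket (x :: 'a::lie_ring) (lie_bracket y z) =
     lie_bracket (lie_bracket x y) z + lie_bracket y (lie_bracket x z)"
proof -
  have "lie_bracket y (lie_bracket z x) = - lie_bracket y (lie_bracket x z)"
    by (subst lie_bracket_swap[of z x]) (rule lie_bracket_minus)
  moreover have "lie_bracket z (lie_bracket x y) = - lie_bracket (lie_bracket x y) z"
    by (rule lie_bracket_swap)
  ultimately show ?thesis
    using lie_jacobi[of x y z] by (simp only: add_eq_0_iff2) (simp add: algebra_simps)
qed

text \<open>Bilinearity is used one argument at a time: the arguments whose brackets land in the
  target span form a subgroup.\<close>

lemma zspan_bracket:
  fixes X Y :: "'a::lie_ring set"
  assumes "\<And>x y. x \<in> X \<Longrightarrow> y \<in> Y \<Longrightarrow> lie_bracket x y \<in> zspan Z"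
    and "x \<in> zspan X" and "y \<in> zspan Y"
  shows "lie_bracket x y \<in> zspan Z"
proof -
  have "zspan Y \<subseteq> {y. lie_bracket x y \<in> zspan Z}" if "x \<in> X" for x
    using assms(1)[OF that]
    by (intro zspan_subset) (auto simp: add_subgroup_def lie_bracket_diff zspan_rules)
  then have "zspan X \<subseteq> {x. \<forall>y\<in>zspan Y. lie_bracket x y \<in> zspan Z}"
    by (intro zspan_subset) (auto simp: add_subgroup_def lie_bracket_diff zspan_rules)
  then show ?thesis
    using assms(2,3) by blast
qed

section \<open>Spanning sets for the components of low degree in \<open>a\<close>\<close>

definition ad_b :: "nat \<Rightarrow> letter free_lie" where
  "ad_b n = (lie_bracket gen_b ^^ n) gen_a"

definition comm2 :: "nat \<Rightarrow> nat \<Rightarrow> letter free_lie" where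
  "comm2 i j = lie_bracket (ad_b i) (ad_b j)"

definition comm3 :: "nat \<Rightarrow> nat \<Rightarrow> nat \<Rightarrow> letter free_lie" where
  "comm3 i j k = lie_bracket (comm2 i j) (ad_b k)"

lemma ad_b_0: "ad_b 0 = gen_a"
  by (simp add: ad_b_def)

lemma bracket_b_ad_b: "lie_bracket gen_b (ad_b n) = ad_b (Suc n)"
  by (simp add: ad_b_def)

lemma bracket_b_comm2: "lie_bracket gen_b (comm2 i j) = comm2 (Suc i) j + comm2 i (Suc j)"
  unfolding comm2_def lie_bracket_derivation[of gen_b "ad_b i" "ad_b j"] bracket_b_ad_b ..

lemma bracket_b_comm3:
  "lie_bracket gen_b (comm3 i j k) = comm3 (Suc i) j k + comm3 i (Suc j) k + comm3 i j (Suc k)"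
  unfolding comm3_def lie_bracket_derivation[of gen_b "comm2 i j" "ad_b k"] bracket_b_ad_b
    bracket_b_comm2 lie_bracket_add_left ..

lemma iter_comm_ad_b: "iter_comm 1 n (ad_b n)"
proof (induction n)
  case 0
  show ?case
    using iter_comm.gen_a by (simp add: ad_b_0)
next
  case (Suc n)
  from iter_comm.bracket[OF iter_comm.gen_b this] show ?case
    by (simp add: bracket_b_ad_b)
qed

lemma iter_comm_comm2: "iter_comm 2 (i + j) (comm2 i j)"
  using iter_comm.bracket[OF iter_comm_ad_b iter_comm_ad_b, of i j]
  by (simp add: comm2_def numeral_2_eq_2)

lemma iter_comm_comm3: "iter_comm 3 (i + j + k) (comm3 i j k)"
  using iter_comm.bracket[OF iter_comm_comm2 iter_comm_ad_b, of i j k]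
  by (simp add: comm3_def numeral_3_eq_3)

text \<open>Meaningful only for \<open>k \<le> 3\<close>.\<close>

definition low_gens :: "nat \<Rightarrow> nat \<Rightarrow> letter free_lie set" where
  "low_gens k m =
     (if k = 0 then {x. x = gen_b \<and> m = 1}
      else if k = 1 then {ad_b m}
      else if k = 2 then {comm2 i j | i j. i + j = m}
      else {comm3 i j h | i j h. i + j + h = m})"

text \<open>The degree bounds leave six pairs \<open>(k, k')\<close>. Brackets with \<open>b\<close>
  are expanded by the Leibniz rule, and the others are generators up to sign. Pairs with
  \<open>k > k'\<close> follow later by antisymmetry.\<close>

lemma low_gens_bracket:
  assumes "x \<in> low_gens k m" and "y \<in> low_gens k' m'" and "k \<le> k'" and "k + k' \<le> 3"
  shows "lie_bracket x y \<in> zspan (low_gens (k + k') (m + m'))"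
proof -
  consider "k = 0" "k' = 0" | "k = 0" "k' = 1" | "k = 0" "k' = 2" | "k = 0" "k' = 3"
    | "k = 1" "k' = 1" | "k = 1" "k' = 2"
    using assms(3,4) by linarith
  then show ?thesis
  proof cases
    case 1
    then show ?thesis
      using assms by (simp add: low_gens_def lie_bracket_self zspan_rules)
  next
    case 2
    then show ?thesis
      using assms by (auto simp: low_gens_def bracket_b_ad_b intro!: zspan_incl)
  next
    case 3
    then obtain i j where "x = gen_b" and m: "m = 1" and "y = comm2 i j" and m': "m' = i + j"
      using assms by (auto simp: low_gens_def)
    moreover have "comm2 (Suc i) j \<in> low_gens 2 (m + m')" "comm2 i (Suc j) \<in> low_gens 2 (m + m')"
      unfolding low_gens_def using m m' by fastforce+
    ultimately show ?thesis
      using 3 by (simp add: bracket_b_comm2 zspan_rules(4) zspan_incl numeral_2_eq_2)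
  next
    case 4
    then obtain i j h where "x = gen_b" and m: "m = 1" and "y = comm3 i j h" and m': "m' = i + j + h"
      using assms by (auto simp: low_gens_def)
    moreover have "comm3 (Suc i) j h \<in> low_gens 3 (m + m')" "comm3 i (Suc j) h \<in> low_gens 3 (m + m')"
      "comm3 i j (Suc h) \<in> low_gens 3 (m + m')"
      unfolding low_gens_def using m m' by fastforce+
    ultimately show ?thesis
      using 4 by (simp add: bracket_b_comm3 zspan_rules(4) zspan_incl numeral_3_eq_3)
  next
    case 5
    then show ?thesis
      using assms by (auto simp: low_gens_def comm2_def intro!: zspan_incl)
  next
    case 6
    then obtain i j where x: "x = ad_b m" and y: "y = comm2 i j" and m': "m' = i + j"
      using assms by (auto simp: low_gens_def)
    have "lie_bracket x y = - comm3 i j m"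
      using lie_bracket_swap[of x y] by (simp add: x y comm3_def)
    moreover have "comm3 i j m \<in> low_gens (k + k') (m + m')"
      using 6 m' by (auto simp: low_gens_def ac_simps)
    ultimately show ?thesis
      by (simp add: zspan_rules(3) zspan_incl)
  qed
qed

lemma iter_comm_low_gens:
  "iter_comm k m x \<Longrightarrow> k \<le> 3 \<Longrightarrow> x \<in> zspan (low_gens k m)"
proof (induction rule: iter_comm.induct)
  case gen_a
  show ?case
    by (rule zspan_incl) (simp add: low_gens_def ad_b_0)
next
  case gen_b
  show ?case
    by (rule zspan_incl) (simp add: low_gens_def)
next
  case (bracket k m x k' m' y)
  then have x: "x \<in> zspan (low_gens k m)" and y: "y \<in> zspan (low_gens k' m')"
    and le: "k + k' \<le> 3"
    by simp_all
  show ?case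
  proof (cases "k \<le> k'")
    case True
    show ?thesis
      by (rule zspan_bracket[OF low_gens_bracket[OF _ _ True le] x y])
  next
    case False
    then have "lie_bracket y x \<in> zspan (low_gens (k' + k) (m' + m))"
      using le by (intro zspan_bracket[OF low_gens_bracket y x]) auto
    then show ?thesis
      using zspan_rules(3) lie_bracket_swap[of x y] by (simp add: add.commute)
  qed
qed

lemma carrier_lie_component_low:
  assumes "k \<in> {2, 3}"
  shows "carrier (lie_component k m) = zspan (low_gens k m)"
proof
  show "carrier (lie_component k m) \<subseteq> zspan (low_gens k m)"
    unfolding carrier_lie_component
    using assms iter_comm_low_gens[of k] by (intro zspan_subset add_subgroup_zspan) auto
  show "zspan (low_gens k m) \<subseteq> carrier (lie_component k m)"
    unfolding carrier_lie_component using assms iter_comm_comm2 iter_comm_comm3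
    by (intro zspan_subset add_subgroup_zspan) (auto simp: low_gens_def intro!: zspan_incl)
qed

section \<open>Basic commutators spanning degrees two and three\<close>

definition index2 :: "nat \<Rightarrow> (nat \<times> nat) set" where
  "index2 m = {(i, j). i < j \<and> i + j = m}"

text \<open>Up to sign these index the basic commutators of weight three in the letters
  \<open>ad_b n\<close>: a smallest letter stands first.\<close>

definition index3 :: "nat \<Rightarrow> (nat \<times> nat \<times> nat) set" where
  "index3 m = {(i, j, k). i < j \<and> i \<le> k \<and> i + j + k = m}"

abbreviation basis2 :: "nat \<times> nat \<Rightarrow> letter free_lie" where
  "basis2 \<equiv> \<lambda>(i, j). comm2 i j"

abbreviation basis3 :: "nat \<times> nat \<times> nat \<Rightarrow> letter free_lie" where
  "basis3 \<equiv> \<lambda>(i, j, k). comm3 i j k"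

lemma comm2_swap: "comm2 i j = - comm2 j i"
  unfolding comm2_def by (rule lie_bracket_swap)

lemma comm3_swap: "comm3 i j k = - comm3 j i k"
  unfolding comm3_def by (subst comm2_swap) (rule lie_bracket_minus)

lemma comm3_jacobi: "comm3 i j k = comm3 k j i - comm3 k i j"
proof -
  let ?a = ad_b
  have "lie_bracket (?a k) (lie_bracket (?a i) (?a j)) =
      lie_bracket (lie_bracket (?a k) (?a i)) (?a j) + lie_bracket (?a i) (lie_bracket (?a k) (?a j))"
    by (rule lie_bracket_derivation)
  then have "- comm3 i j k = comm3 k i j - comm3 k j i"
    unfolding lie_bracket_swap[of "?a k" "lie_bracket (?a i) (?a j)"]
      lie_bracket_swap[of "?a i" "lie_bracket (?a k) (?a j)"]
    by (simp add: comm3_def comm2_def)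
  then show ?thesis
    by (metis minus_diff_eq minus_equation_iff)
qed

lemma comm2_in_span: "comm2 i j \<in> zspan (basis2 ` index2 (i + j))"
proof -
  have *: "comm2 i j \<in> zspan (basis2 ` index2 (i + j))" if "i < j" for i j
    using that by (intro zspan_incl) (auto simp: index2_def)
  consider "i < j" | "j < i" | "i = j" by linarith
  then show ?thesis
  proof cases
    case 2
    then show ?thesis
      using zspan_rules(3)[OF *[of j i]] by (simp add: comm2_swap[of i j] add.commute)
  next
    case 3
    then show ?thesis
      by (simp add: comm2_def lie_bracket_self zspan_rules)
  qed (rule *)
qed

lemma comm3_in_span: "comm3 i j k \<in> zspan (basis3 ` index3 (i + j + k))"
proof -
  \<comment> \<open>The total \<open>m\<close> is a separate variable so that the fact applies
    directly to permuted indices.\<close>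
  have 1: "comm3 i j k \<in> zspan (basis3 ` index3 m)" if "i < j" "i \<le> k" "m = i + j + k" for i j k m
    using that by (intro zspan_incl) (auto simp: index3_def image_iff intro!: bexI[of _ "(i, j, k)"])
  have *: "comm3 i j k \<in> zspan (basis3 ` index3 m)" if "i < j" "m = i + j + k" for i j k m
  proof (cases "i \<le> k")
    case False
    \<comment> \<open>Here \<open>k < i < j\<close>, and Jacobi rewrites the commutator as a
      difference of two with \<open>k\<close> in front, both indexed by
      \<open>index3\<close>.\<close>
    show ?thesis
      unfolding comm3_jacobi[of i j k]
      by (intro zspan_rules(2) 1) (use False that in auto)
  qed (use 1 that in auto)
  consider "i < j" | "j < i" | "i = j" by linarith
  then show ?thesis
  proof cases
    case 2
    then show ?thesis
      unfolding comm3_swap[of i j k] by (intro zspan_rules(3) *) auto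
  next
    case 3
    then show ?thesis
      by (simp add: comm3_def comm2_def lie_bracket_self zspan_rules)
  qed (use * in auto)
qed

lemma carrier_lie_component_2: "carrier (lie_component 2 m) = zspan (basis2 ` index2 m)"
proof
  show "carrier (lie_component 2 m) \<subseteq> zspan (basis2 ` index2 m)"
    unfolding carrier_lie_component_low[of 2, simplified]
    by (intro zspan_subset add_subgroup_zspan) (auto simp: low_gens_def comm2_in_span)
  show "zspan (basis2 ` index2 m) \<subseteq> carrier (lie_component 2 m)"
    unfolding carrier_lie_component_low[of 2, simplified]
    by (intro zspan_subset add_subgroup_zspan)
       (auto simp: low_gens_def index2_def intro!: zspan_incl)
qed

lemma carrier_lie_component_3: "carrier (lie_component 3 m) = zspan (basis3 ` index3 m)"
proof
  show "carrier (lie_component 3 m) \<subseteq> zspan (basis3 ` index3 m)"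
    unfolding carrier_lie_component_low[of 3, simplified]
    by (intro zspan_subset add_subgroup_zspan) (auto simp: low_gens_def comm3_in_span)
  show "zspan (basis3 ` index3 m) \<subseteq> carrier (lie_component 3 m)"
    unfolding carrier_lie_component_low[of 3, simplified]
    by (intro zspan_subset add_subgroup_zspan)
       (auto simp: low_gens_def index3_def intro!: zspan_incl)
qed

section \<open>A Lie ring detecting the components of degree at most three in \<open>a\<close>\<close>

text \<open>
  \<open>c1\<close>, \<open>c2\<close>, \<open>c3\<close> are the coefficients of tensors of degree 1, 2, 3 in letters indexed by the
  integers (standing for \<open>ad_b n\<close>), with tensors of higher degree discarded. On these \<open>c0\<close>, the
  coefficient of \<open>b\<close>, acts by the derivation that raises the index of each letter by one.
  Integer rather than natural indices avoid a case distinction in the shift.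
\<close>

datatype tensor3 = Tensor3 (c0: int) (c1: "int \<Rightarrow> int") (c2: "int \<Rightarrow> int \<Rightarrow> int")
  (c3: "int \<Rightarrow> int \<Rightarrow> int \<Rightarrow> int")

instantiation tensor3 :: lie_ring
begin

definition zero_tensor3 :: tensor3 where
  "zero_tensor3 = Tensor3 0 (\<lambda>_. 0) (\<lambda>_ _. 0) (\<lambda>_ _ _. 0)"

definition plus_tensor3 :: "tensor3 \<Rightarrow> tensor3 \<Rightarrow> tensor3" where
  "plus_tensor3 x y = Tensor3 (c0 x + c0 y) (\<lambda>i. c1 x i + c1 y i) (\<lambda>i j. c2 x i j + c2 y i j)
     (\<lambda>i j k. c3 x i j k + c3 y i j k)"

definition minus_tensor3 :: "tensor3 \<Rightarrow> tensor3 \<Rightarrow> tensor3" where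
  "minus_tensor3 x y = Tensor3 (c0 x - c0 y) (\<lambda>i. c1 x i - c1 y i) (\<lambda>i j. c2 x i j - c2 y i j)
     (\<lambda>i j k. c3 x i j k - c3 y i j k)"

definition uminus_tensor3 :: "tensor3 \<Rightarrow> tensor3" where
  "uminus_tensor3 x = Tensor3 (- c0 x) (\<lambda>i. - c1 x i) (\<lambda>i j. - c2 x i j) (\<lambda>i j k. - c3 x i j k)"

text \<open>The bracket of a semidirect product: the commutator of truncated tensors, plus
  \<open>c0 x\<close> times the derivative of \<open>y\<close>, minus \<open>c0 y\<close> times the
  derivative of \<open>x\<close>. Raising one letter of a word moves a coefficient from index
  \<open>i - 1\<close> to \<open>i\<close>.\<close>

definition lie_bracket_tensor3 :: "tensor3 \<Rightarrow> tensor3 \<Rightarrow> tensor3" where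
  "lie_bracket_tensor3 x y = Tensor3 0
     (\<lambda>i. c0 x * c1 y (i - 1) - c0 y * c1 x (i - 1))
     (\<lambda>i j. c0 x * (c2 y (i - 1) j + c2 y i (j - 1)) - c0 y * (c2 x (i - 1) j + c2 x i (j - 1))
        + c1 x i * c1 y j - c1 y i * c1 x j)
     (\<lambda>i j k. c0 x * (c3 y (i - 1) j k + c3 y i (j - 1) k + c3 y i j (k - 1))
        - c0 y * (c3 x (i - 1) j k + c3 x i (j - 1) k + c3 x i j (k - 1))
        + c1 x i * c2 y j k + c2 x i j * c1 y k - c1 y i * c2 x j k - c2 y i j * c1 x k)"

instance
proof
  fix x y z :: tensor3
  note defs = zero_tensor3_def plus_tensor3_def minus_tensor3_def uminus_tensor3_def
  show "x + y + z = x + (y + z)" "x + y = y + x" "0 + x = x" "- x + x = 0" "x - y = x + - y"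
    by (simp_all add: defs fun_eq_iff)
  show "lie_bracket (x + y) z = lie_bracket x z + lie_bracket y z"
    "lie_bracket x (y + z) = lie_bracket x y + lie_bracket x z"
    by (simp_all add: defs lie_bracket_tensor3_def fun_eq_iff algebra_simps)
  show "lie_bracket x x = 0"
    by (simp add: defs lie_bracket_tensor3_def)
  \<comment> \<open>Coefficient by coefficient, the Jacobi sum is a polynomial identity in the
    shifted coefficients of \<open>x\<close>, \<open>y\<close>, \<open>z\<close>.\<close>
  have "c3 (lie_bracket x (lie_bracket y z) + lie_bracket y (lie_bracket z x)
          + lie_bracket z (lie_bracket x y)) i j k = 0" for i j k
    unfolding defs lie_bracket_tensor3_def tensor3.sel by algebra
  moreover have "c2 (lie_bracket x (lie_bracket y z) + lie_bracket y (lie_bracket z x)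
          + lie_bracket z (lie_bracket x y)) i j = 0" for i j
    unfolding defs lie_bracket_tensor3_def tensor3.sel by algebra
  moreover have "c1 (lie_bracket x (lie_bracket y z) + lie_bracket y (lie_bracket z x)
          + lie_bracket z (lie_bracket x y)) i = 0" for i
    unfolding defs lie_bracket_tensor3_def tensor3.sel by algebra
  moreover have "c0 (lie_bracket x (lie_bracket y z) + lie_bracket y (lie_bracket z x)
          + lie_bracket z (lie_bracket x y)) = 0"
    by (simp add: defs lie_bracket_tensor3_def)
  ultimately show "lie_bracket x (lie_bracket y z) + lie_bracket y (lie_bracket z x)
      + lie_bracket z (lie_bracket x y) = 0"
    by (intro tensor3.expand) (simp add: zero_tensor3_def fun_eq_iff)
qed

end

section \<open>The detecting homomorphism and the dual coordinates\<close>

lemma tensor3_sel_simps [simp]: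
  "c2 (x + y) i j = c2 x i j + c2 y i j" "c3 (x + y) i j k = c3 x i j k + c3 y i j k"
  by (simp_all add: plus_tensor3_def)

text \<open>The homomorphism given by the universal property, sending \<open>a\<close> to the letter
  of index 0 and \<open>b\<close> to the shift derivation. It maps \<open>ad_b n\<close> to the
  letter of index \<open>n\<close>.\<close>

definition tensor_of :: "letter free_lie \<Rightarrow> tensor3" where
  "tensor_of = (SOME h. lie_hom h \<and>
     h gen_a = Tensor3 0 (\<lambda>i. of_bool (i = 0)) (\<lambda>_ _. 0) (\<lambda>_ _ _. 0) \<and>
     h gen_b = Tensor3 1 (\<lambda>_. 0) (\<lambda>_ _. 0) (\<lambda>_ _ _. 0))"

lemma tensor_of:
  "lie_hom tensor_of"
  "tensor_of gen_a = Tensor3 0 (\<lambda>i. of_bool (i = 0)) (\<lambda>_ _. 0) (\<lambda>_ _ _. 0)"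
  "tensor_of gen_b = Tensor3 1 (\<lambda>_. 0) (\<lambda>_ _. 0) (\<lambda>_ _ _. 0)"
proof -
  let ?A = "Tensor3 0 (\<lambda>i. of_bool (i = 0)) (\<lambda>_ _. 0) (\<lambda>_ _ _. 0)"
  let ?B = "Tensor3 1 (\<lambda>_. 0) (\<lambda>_ _. 0) (\<lambda>_ _ _. 0)"
  obtain h where h: "lie_hom h" "\<And>c. h (free_lie_of c) = (case c of Letter_A \<Rightarrow> ?A | Letter_B \<Rightarrow> ?B)"
    using free_lie_universal[of "\<lambda>c. case c of Letter_A \<Rightarrow> ?A | Letter_B \<Rightarrow> ?B"] by blast
  then have "\<exists>h. lie_hom h \<and> h gen_a = ?A \<and> h gen_b = ?B"
    by (intro exI[of _ h]) simp
  from someI_ex[OF this]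
  show "lie_hom tensor_of" "tensor_of gen_a = ?A" "tensor_of gen_b = ?B"
    unfolding tensor_of_def by blast+
qed

lemma tensor_of_simps [simp]:
  "tensor_of (x + y) = tensor_of x + tensor_of y"
  "tensor_of (lie_bracket x y) = lie_bracket (tensor_of x) (tensor_of y)"
  using tensor_of(1) by (simp_all add: lie_hom_def)

lemma tensor_of_ad_b:
  "tensor_of (ad_b n) = Tensor3 0 (\<lambda>i. of_bool (i = int n)) (\<lambda>_ _. 0) (\<lambda>_ _ _. 0)"
proof (induction n)
  case 0
  show ?case
    by (simp add: ad_b_0 tensor_of)
next
  case (Suc n)
  show ?case
    unfolding bracket_b_ad_b[symmetric] tensor_of_simps Suc tensor_of
    by (auto simp: lie_bracket_tensor3_def fun_eq_iff)
qed

lemma c2_comm2: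
  "c2 (tensor_of (comm2 p q)) i j =
     of_bool (i = int p \<and> j = int q) - of_bool (i = int q \<and> j = int p)"
  by (simp add: comm2_def tensor_of_ad_b lie_bracket_tensor3_def of_bool_conj)

text \<open>The expansion \<open>[[p,q],r] = pqr - qpr - rpq + rqp\<close> in words.\<close>

lemma c3_comm3:
  "c3 (tensor_of (comm3 p q r)) i j k =
     of_bool (i = int p \<and> j = int q \<and> k = int r) - of_bool (i = int q \<and> j = int p \<and> k = int r)
     - of_bool (i = int r \<and> j = int p \<and> k = int q) + of_bool (i = int r \<and> j = int q \<and> k = int p)"
  by (simp add: comm3_def comm2_def tensor_of_ad_b lie_bracket_tensor3_def of_bool_conj algebra_simps
     del: of_bool_eq_iff)

definition coord2 :: "nat \<times> nat \<Rightarrow> letter free_lie \<Rightarrow> int" where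
  "coord2 = (\<lambda>(i, j) x. c2 (tensor_of x) (int i) (int j))"

text \<open>
  For \<open>i = k\<close> the word \<open>iji\<close> occurs with coefficient 2 in \<open>comm3 i j i\<close>, so the coefficient
  of \<open>jii\<close> is used instead.
\<close>

definition coord3 :: "nat \<times> nat \<times> nat \<Rightarrow> letter free_lie \<Rightarrow> int" where
  "coord3 = (\<lambda>(i, j, k) x. if i = k then - c3 (tensor_of x) (int j) (int i) (int i)
     else c3 (tensor_of x) (int i) (int j) (int k))"

lemma finite_index2: "finite (index2 m)"
  by (rule finite_subset[of _ "{..m} \<times> {..m}"]) (auto simp: index2_def)

lemma finite_index3: "finite (index3 m)"
  by (rule finite_subset[of _ "{..m} \<times> {..m} \<times> {..m}"]) (auto simp: index3_def)

lemma coord2_comm2: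
  "i < j \<Longrightarrow> p < q \<Longrightarrow> coord2 (i, j) (comm2 p q) = of_bool (i = p \<and> j = q)"
  by (auto simp: coord2_def c2_comm2)

lemma additive_coord: "additive_on UNIV (coord2 s)" "additive_on UNIV (coord3 t)"
  by (cases s, simp add: additive_on_def coord2_def, cases t, simp add: additive_on_def coord3_def)

lemma has_rank_lie_component_2: "has_rank (carrier (lie_component 2 m)) (card (index2 m))"
proof -
  have "zbasis (index2 m) basis2 coord2 (zspan (basis2 ` index2 m))"
  proof (rule zbasis_zspan)
    show "coord2 s (basis2 t) = of_bool (s = t)" if "s \<in> index2 m" "t \<in> index2 m" for s t
      using that by (cases s; cases t) (simp add: index2_def coord2_comm2)
  qed (simp_all add: finite_index2 additive_coord)
  then show ?thesis
    unfolding carrier_lie_component_2 by (rule has_rankI)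
qed

lemma coord3_comm3:
  assumes ij: "i < j" "i \<le> k" and pq: "p < q" "p \<le> r"
  shows "coord3 (i, j, k) (comm3 p q r) = of_bool (i = p \<and> j = q \<and> k = r)"
proof (cases "i = k")
  case True
  \<comment> \<open>The word is \<open>jii\<close> with \<open>i < j\<close>. Of the four words in
    \<open>c3_comm3\<close>, \<open>p < q\<close> and \<open>p \<le> r\<close> allow only
    \<open>qpr\<close>, which carries a minus sign.\<close>
  have "c3 (tensor_of (comm3 p q r)) (int j) (int i) (int i) =
      0 - of_bool (i = p \<and> j = q \<and> k = r) - 0 + 0"
    unfolding c3_comm3 using ij pq True
    by (intro arg_cong2[where f="(+)"] arg_cong2[where f="(-)"]) auto
  then show ?thesis
    using True by (simp add: coord3_def)
next
  case False
  \<comment> \<open>Now \<open>i\<close> is strictly the smallest letter of \<open>ijk\<close>, so a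
    matching word must start with its unique smallest letter; only \<open>pqr\<close> can.\<close>
  have "c3 (tensor_of (comm3 p q r)) (int i) (int j) (int k) =
      of_bool (i = p \<and> j = q \<and> k = r) - 0 - 0 + 0"
    unfolding c3_comm3 using ij pq False
    by (intro arg_cong2[where f="(+)"] arg_cong2[where f="(-)"]) auto
  then show ?thesis
    using False by (simp add: coord3_def)
qed

lemma has_rank_lie_component_3: "has_rank (carrier (lie_component 3 m)) (card (index3 m))"
proof -
  have "zbasis (index3 m) basis3 coord3 (zspan (basis3 ` index3 m))"
  proof (rule zbasis_zspan)
    show "coord3 s (basis3 t) = of_bool (s = t)" if "s \<in> index3 m" "t \<in> index3 m" for s t
      using that by (cases s; cases t) (simp add: index3_def coord3_comm3)
  qed (simp_all add: finite_index3 additive_coord)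
  then show ?thesis
    unfolding carrier_lie_component_3 by (rule has_rankI)
qed

section \<open>Counting the basis indices\<close>

lemma card_index2: "card (index2 m) = (m + 1) div 2"
proof -
  have "index2 m = (\<lambda>i. (i, m - i)) ` {..<(m + 1) div 2}"
    by (auto simp: index2_def image_iff)
  then show ?thesis
    by (simp add: card_image inj_on_def)
qed

lemma card_index3: "card (index3 (Suc m)) = card (index3 m) + m div 3 + 1"
proof -
  \<comment> \<open>\<open>?f\<close> produces the triples with \<open>k > i\<close>,
    \<open>?g\<close> those with \<open>k = i\<close>. In the latter
    \<open>j = Suc m - 2 * i\<close> exceeds \<open>i\<close> exactly when
    \<open>3 * i \<le> m\<close>, whence the range \<open>{..m div 3}\<close>.\<close>
  let ?f = "\<lambda>(i, j, k). (i, j, Suc k)" and ?g = "\<lambda>i. (i, Suc m - 2 * i, i)"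
  have "index3 (Suc m) \<subseteq> ?f ` index3 m \<union> ?g ` {..m div 3}"
  proof clarify
    fix i j k assume ijk: "(i, j, k) \<in> index3 (Suc m)" "(i, j, k) \<notin> ?g ` {..m div 3}"
    then have "k \<noteq> i"
      by (auto simp: index3_def image_iff)
    then have "(i, j, k - 1) \<in> index3 m" "(i, j, k) = ?f (i, j, k - 1)"
      using ijk(1) by (auto simp: index3_def)
    then show "(i, j, k) \<in> ?f ` index3 m"
      by blast
  qed
  then have "index3 (Suc m) = ?f ` index3 m \<union> ?g ` {..m div 3}"
    by (auto simp: index3_def)
  moreover have "?f ` index3 m \<inter> ?g ` {..m div 3} = {}"
    by (auto simp: index3_def)
  ultimately have "card (index3 (Suc m)) = card (?f ` index3 m) + card (?g ` {..m div 3})"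
    by (simp add: card_Un_disjoint finite_index3)
  also have "card (?f ` index3 m) = card (index3 m)"
    by (rule card_image) (auto simp: inj_on_def)
  also have "card (?g ` {..m div 3}) = m div 3 + 1"
    by (subst card_image) (auto simp: inj_on_def)
  finally show ?thesis by simp
qed

section \<open>The kernel of \<open>Theta\<close>\<close>

text \<open>Integration by parts: \<open>comm3 i j (Suc k)\<close> is a bracket with
  \<open>b\<close> minus two commutators with last index \<open>k\<close>. The descent ends at last
  index 0, where the commutator is a bracket with \<open>a\<close>.\<close>

lemma Theta_image:
  "Theta ` (carrier (lie_component 2 (Suc m)) \<times> carrier (lie_component 3 m)) =
     carrier (lie_component 3 (Suc m))" (is "Theta ` ?G = ?L")
proof
  show "Theta ` ?G \<subseteq> ?L"
    using hom_carrier[OF Theta_hom[of 3 "Suc m"]] by simp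
  have G: "add_subgroup ?G"
    by (auto simp: carrier_lie_component add_subgroup_def zspan_rules zero_prod_def)
  have f: "additive_on ?G Theta"
    by (auto simp: additive_on_def Theta_def lie_bracket_add_left)
  have I: "add_subgroup (Theta ` ?G)"
    by (rule add_subgroup_image[OF G f])
  have "comm3 i j k \<in> Theta ` ?G" if "i + j + k = Suc m" for i j k
    using that
  proof (induction k arbitrary: i j)
    case 0
    have "comm3 i j 0 = Theta (comm2 i j, 0)"
      by (simp add: comm3_def Theta_def ad_b_0)
    moreover have "(comm2 i j, 0) \<in> ?G"
      using iter_comm_comm2[of i j] 0 by (auto simp: carrier_lie_component zspan_incl zspan_rules)
    ultimately show ?case
      by (rule image_eqI)
  next
    case (Suc k)
    have "comm3 i j k \<in> carrier (lie_component 3 m)"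
      using iter_comm_comm3[of i j k] Suc.prems by (auto simp: carrier_lie_component zspan_incl)
    \<comment> \<open>The sign appears because \<open>Theta\<close> brackets with \<open>b\<close>
      on the right.\<close>
    then have "(0, - comm3 i j k) \<in> ?G"
      by (auto simp: carrier_lie_component zspan_rules)
    moreover have "lie_bracket gen_b (comm3 i j k) = Theta (0, - comm3 i j k)"
      using lie_bracket_swap[of gen_b] by (simp add: Theta_def lie_bracket_minus)
    ultimately have "lie_bracket gen_b (comm3 i j k) \<in> Theta ` ?G"
      by blast
    moreover have "comm3 i j (Suc k) =
        lie_bracket gen_b (comm3 i j k) - comm3 (Suc i) j k - comm3 i (Suc j) k"
      by (simp add: bracket_b_comm3)
    moreover have "comm3 (Suc i) j k \<in> Theta ` ?G" "comm3 i (Suc j) k \<in> Theta ` ?G"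
      using Suc.IH[of "Suc i" j] Suc.IH[of i "Suc j"] Suc.prems by simp_all
    ultimately show ?case
      by (simp only: add_subgroupD(2)[OF I])
  qed
  then have "zspan (basis3 ` index3 (Suc m)) \<subseteq> Theta ` ?G"
    by (intro zspan_subset I) (auto simp: index3_def simp del: mem_Sigma_iff)
  then show "?L \<subseteq> Theta ` ?G"
    by (simp only: carrier_lie_component_3[of "Suc m"])
qed

lemma Theta_kernel_eq:
  "Theta_kernel k m = subgroup_monoid
     {z \<in> carrier (lie_component (k - 1) m) \<times> carrier (lie_component k (m - 1)). Theta z = 0}"
proof -
  have 1: "\<one>\<^bsub>lie_component k m\<^esub> = 0" for k m
    by (simp add: lie_component_def)
  have "carrier (Theta_kernel k m) =
      {z \<in> carrier (lie_component (k - 1) m) \<times> carrier (lie_component k (m - 1)). Theta z = 0}"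
    by (simp add: Theta_kernel_def Let_def kernel_def 1)
  moreover have "monoid.mult (Theta_kernel k m) = (+)"
    by (simp add: Theta_kernel_def Let_def DirProd_def fun_eq_iff)
  moreover have "one (Theta_kernel k m) = 0"
    by (simp add: Theta_kernel_def Let_def DirProd_def zero_prod_def 1)
  ultimately show ?thesis
    unfolding subgroup_monoid_def by (intro monoid.equality) simp_all
qed

text \<open>Here \<open>m\<close> is one less than in the theorem, and the rank formula is kept
  additive to avoid truncated subtraction. The term \<open>card (index3 m)\<close> cancels by
  \<open>card_index3\<close>.\<close>

lemma Theta_kernel_rank:
  "\<exists>q. has_rank {z \<in> carrier (lie_component 2 (Suc m)) \<times> carrier (lie_component 3 m). Theta z = 0} q
     \<and> q + m div 3 + 1 = (m + 2) div 2"
proof -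
  let ?G = "carrier (lie_component 2 (Suc m)) \<times> carrier (lie_component 3 m)"
  have "has_rank ?G (card (index2 (Suc m)) + card (index3 m))"
    by (intro has_rank_Times has_rank_lie_component_2 has_rank_lie_component_3)
  moreover have "additive_on ?G Theta"
    by (auto simp: additive_on_def Theta_def lie_bracket_add_left)
  moreover have "has_rank (Theta ` ?G) (card (index3 (Suc m)))"
    unfolding Theta_image by (rule has_rank_lie_component_3)
  ultimately obtain q where "has_rank {z \<in> ?G. Theta z = 0} q"
    and "q + card (index3 (Suc m)) = card (index2 (Suc m)) + card (index3 m)"
    using rank_nullity by blast
  then show ?thesis
    by (intro exI[of _ q]) (simp add: card_index2 card_index3)
qed

theorem proposition2p5:
  fixes m :: nat
  assumes "m \<ge> 1"
  shows "Theta_kernel 3 m \<cong> free_Abelian_group {..<free_rank (Theta_kernel 3 m)} \<and>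
         int (free_rank (Theta_kernel 3 m)) = \<lceil>real m / 2\<rceil> - \<lfloor>(real m - 1) / 3\<rfloor> - 1"
proof -
  obtain n where m: "m = Suc n"
    using assms by (cases m) auto
  obtain q where q: "has_rank {z \<in> carrier (lie_component 2 (Suc n)) \<times>
      carrier (lie_component 3 n). Theta z = 0} q" and eq: "q + n div 3 + 1 = (n + 2) div 2"
    using Theta_kernel_rank by blast
  have iso: "Theta_kernel 3 m \<cong> free_Abelian_group {..<q}"
    using has_rank_iso[OF q] by (simp add: Theta_kernel_eq m)
  have "group (Theta_kernel 3 m)"
    using q by (auto simp: Theta_kernel_eq m has_rank_def zbasis_def intro!: group_subgroup_monoid)
  with iso have rank: "free_rank (Theta_kernel 3 m) = q"
    by (rule free_rank_eqI)
  \<comment> \<open>The ceiling is pinned down by two integer inequalities, after which the claim is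
    pure integer arithmetic with \<open>m = Suc n\<close>.\<close>
  have "\<lceil>real m / 2\<rceil> = (int n + 2) div 2"
  proof -
    have "2 * \<lceil>real m / 2\<rceil> - 2 < int m \<and> int m \<le> 2 * \<lceil>real m / 2\<rceil>"
      by linarith
    then show ?thesis
      unfolding m by presburger
  qed
  moreover have "\<lfloor>(real m - 1) / 3\<rfloor> = int n div 3"
    using floor_divide_of_nat_eq[of n 3] by (simp add: m zdiv_int)
  ultimately show ?thesis
    using iso arg_cong[OF eq, of int] by (simp add: rank zdiv_int)
qed

end
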